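(* Let $r \geq 3$ and $n\geq k+1 \geq r+4$ be integers. If $\mathcal H$ is a connected $n$-vertex $r$-uniform hypergraph with no Berge path of length $k$, then $$e(\mathcal H) \leq \frac{n-1}{k-2}\binom{k-1}{r}.$$
   Context: An $r$-uniform hypergraph ($r$-graph) $\mathcal H$ is a family of (distinct) $r$-element subsets, called edges or hyperedges, of a finite vertex set $V(\mathcal H)$; $e(\mathcal H)=|\mathcal H|$ is its number of edges, and "$n$-vertex" means $|V(\mathcal H)|=n$. A Berge path of length $\ell$ in $\mathcal H$ consists of $\ell+1$ distinct vertices $v_1,\dots,v_{\ell+1}$ and $\ell$ distinct hyperedges $e_1,\dots,e_\ell$ of $\mathcal H$ such that $\{v_i,v_{i+1}\}\subseteq e_i$ for all $1\le i\le \ell$. $\mathcal H$ is connected if its 2-shadow, i.e. the graph on $V(\mathcal H)$ whose edges are the pairs contained in some edge of $\mathcal H$, is connected. *)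

theory Defs
  imports Complex_Main
begin

definition uniform_hypergraph :: "nat \<Rightarrow> 'a set \<Rightarrow> 'a set set \<Rightarrow> bool" where
  "uniform_hypergraph r V H \<longleftrightarrow> finite V \<and> (\<forall>e\<in>H. e \<subseteq> V \<and> card e = r)"

(* Vertices and edges are listed from index 0, so vs ! i is the vertex v_{i+1} of the
   usual notation v_1, ..., v_{l+1}, and es ! i is e_{i+1}. *)
definition berge_path :: "'a set \<Rightarrow> 'a set set \<Rightarrow> nat \<Rightarrow> 'a list \<Rightarrow> 'a set list \<Rightarrow> bool" where
  "berge_path V H l vs es \<longleftrightarrow>
     length vs = l + 1 \<and> distinct vs \<and> set vs \<subseteq> V \<and>
     length es = l \<and> distinct es \<and> set es \<subseteq> H \<and>
     (\<forall>i<l. {vs ! i, vs ! (i + 1)} \<subseteq> es ! i)"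

definition two_shadow :: "'a set set \<Rightarrow> ('a \<times> 'a) set" where
  "two_shadow H = {(u, v). u \<noteq> v \<and> (\<exists>e\<in>H. {u, v} \<subseteq> e)}"

definition connected_hypergraph :: "'a set \<Rightarrow> 'a set set \<Rightarrow> bool" where
  "connected_hypergraph V H \<longleftrightarrow> (\<forall>u\<in>V. \<forall>v\<in>V. (u, v) \<in> (two_shadow H)\<^sup>*)"

end

theory Submission imports Defs begin

text \<open>
  The hypergraph question is turned into a question about a graph. Take a set \<open>A\<close> of hyperedges for
  which the excess of \<open>|A|\<close> over the number of pairs covered by \<open>A\<close> is as large as possible. Colour
  the covered pairs blue. Maximality of the excess is exactly Hall's condition in two directions:
  the blue pairs can be matched injectively into \<open>A\<close>, and the hyperedges outside \<open>A\<close> can be matched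
  injectively to pairs that are not blue, which are then coloured red. Every hyperedge in \<open>A\<close> is a
  blue \<open>r\<close>-clique, so the number of hyperedges is at most the number of red edges plus the number of
  blue \<open>r\<close>-cliques, while every red or blue edge has its own hyperedge containing it
  (\<open>red_blue_representation\<close>).

  Hence a cycle of length at least \<open>k\<close> in the coloured graph lifts to a Berge cycle of the same length.
  A Berge cycle of length more than \<open>k\<close> contains a Berge path of length \<open>k\<close>. A Berge cycle of
  length exactly \<open>k\<close> misses a vertex, so by connectedness some hyperedge leaves its vertex set, and
  opening the cycle next to that hyperedge gives a Berge path of length \<open>k\<close>
  (\<open>berge_path_of_long_cycle\<close>). So all cycles in the coloured graph have length at most
  \<open>m = k - 1\<close>.

  It remains to bound red edges plus blue \<open>r\<close>-cliques in such a graph on \<open>n\<close> vertices by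
  \<open>a (n - 1)\<close>, where \<open>a = (m choose r) / (m - 1)\<close> (\<open>coloured_clique_bound\<close>).
  This goes by deleting a nonempty proper set \<open>S\<close> of vertices that destroys at most \<open>a |S|\<close> of these
  objects. Among all longest paths take one whose first vertex has maximum degree, and let \<open>S\<close> consist
  of the predecessors on the path of the neighbours of the first vertex. Each vertex of \<open>S\<close> starts
  another longest path, obtained by reversing an initial segment; so its degree is at most \<open>|S|\<close>, and
  since cycles are short its neighbours are among the first \<open>m\<close> vertices of the path
  (\<open>removable_set\<close>). A vertex of \<open>S\<close> with \<open>x\<close> neighbours inside and \<open>y\<close> neighbours outside \<open>S\<close>
  therefore satisfies \<open>x + 2y \<le> m\<close>. If each destroyed clique is charged evenly to its vertices in
  \<open>S\<close>, convexity of binomial coefficients shows that a vertex pays at most \<open>q (x/2 + y)\<close> with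
  \<open>q = (m choose r) / (m choose 2)\<close> (\<open>share_le\<close>). A red edge is a 2-clique, for which the
  corresponding factor is \<open>1\<close>, and \<open>q \<ge> 1\<close> because \<open>r \<le> m - 2\<close>. The two colours together
  hence cost a vertex at most \<open>q m / 2 = a\<close>.
\<close>

section \<open>Binomial estimates\<close>

text \<open>
  Convexity of \<open>i \<mapsto> i choose s\<close>: its increments \<open>i choose (s - 1)\<close> grow with \<open>i\<close>, so the same
  step \<open>t\<close> gains more from the larger of two arguments.
\<close>

lemma choose_spread:
  assumes "i \<le> j"
  shows "((i + t) choose s) + (j choose s) \<le> (i choose s) + ((j + t) choose s)"
proof (cases s)
  case (Suc s')
  show ?thesis
  proof (induction t)
    case (Suc t)
    have "(i + t) choose s' \<le> (j + t) choose s'"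
      using assms by (intro binomial_right_mono) simp
    then show ?case using Suc \<open>s = Suc s'\<close> by simp
  qed simp
qed simp

lemma twice_sum_choose_le:
  assumes "1 \<le> l"
  shows "2 * (\<Sum>i=l..h. i choose s) \<le> (Suc h - l) * ((l - 1 choose s) + (Suc h choose s))"
proof -
  \<comment> \<open>Reflecting the interval pairs \<open>i\<close> with \<open>l + h - i\<close>; both lie between the two outer points.\<close>
  have pair: "(i choose s) + (l + h - i choose s) \<le> (l - 1 choose s) + (Suc h choose s)"
    if i: "i \<in> {l..h}" for i
  proof -
    have "l - 1 \<le> l + h - i" and *: "l - 1 + (Suc i - l) = i" "l + h - i + (Suc i - l) = Suc h"
      using assms i by auto
    from choose_spread[OF this(1), of "Suc i - l" s] show ?thesis unfolding * by simp
  qed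
  have "(\<Sum>i=l..h. i choose s) = (\<Sum>i=l..h. l + h - i choose s)"
    by (rule sum.reindex_bij_witness[of _ "\<lambda>i. l + h - i" "\<lambda>i. l + h - i"]) auto
  then have "2 * (\<Sum>i=l..h. i choose s) = (\<Sum>i=l..h. (i choose s) + (l + h - i choose s))"
    by (simp add: sum.distrib)
  also have "\<dots> \<le> (\<Sum>i=l..h. (l - 1 choose s) + (Suc h choose s))"
    by (intro sum_mono pair)
  finally show ?thesis by simp
qed

text \<open>
  The average of a convex function over an interval grows when the interval is extended equally on
  both sides; here \<open>{l..h}\<close> is extended to the interval with the same centre that starts at \<open>1\<close>.
  The induction adds one point on either side, which by the previous lemma does not lower the
  average.
\<close>

lemma average_choose_le:
  assumes "1 \<le> l"
  shows "(l + h - 1) * (\<Sum>i=l..h. i choose s) \<le> (Suc h - l) * (\<Sum>i=1..l + h - 1. i choose s)"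
  using assms
proof (induction l arbitrary: h rule: nat_induct_at_least)
  case base
  show ?case by simp
next
  case (Suc l)
  show ?case
  proof (cases "Suc l \<le> h")
    case True
    define n where "n = h - l"
    define A where "A = (\<Sum>i=Suc l..h. i choose s)"
    define A' where "A' = (\<Sum>i=l..Suc h. i choose s)"
    define M where "M = (\<Sum>i=1..l + h. i choose s)"
    have "2 * A \<le> n * ((l choose s) + (Suc h choose s))"
      using twice_sum_choose_le[where l = "Suc l" and h = h and s = s] by (simp add: A_def n_def)
    moreover have "A' = A + (l choose s) + (Suc h choose s)"
      using True by (simp add: A_def A'_def sum.atLeast_Suc_atMost[of l])
    ultimately have step: "(n + 2) * A \<le> n * A'"
      by (simp add: algebra_simps)
    have IH: "(l + h) * A' \<le> (n + 2) * M"
      using Suc.IH[of "Suc h"] True unfolding A'_def M_def n_def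
      by (simp add: Suc_diff_le)
    have "(n + 2) * ((l + h) * A) = (l + h) * ((n + 2) * A)" by (simp add: algebra_simps)
    also have "\<dots> \<le> (l + h) * (n * A')" using step by (rule mult_left_mono) simp
    also have "\<dots> = n * ((l + h) * A')" by (simp add: algebra_simps)
    also have "\<dots> \<le> n * ((n + 2) * M)" using IH by (rule mult_left_mono) simp
    also have "\<dots> = (n + 2) * (n * M)" by (simp add: algebra_simps)
    finally have "(l + h) * A \<le> n * M" by (simp only: nat_mult_le_cancel_disj)
    then show ?thesis by (simp add: A_def M_def n_def)
  qed simp
qed

text \<open>
  Since \<open>(t choose r) (r choose 2) = (t choose 2) ((t - 2) choose (r - 2))\<close>, the quotient
  \<open>(t choose r) / (t choose 2)\<close> is nondecreasing in \<open>t\<close>.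
\<close>

lemma choose_ratio_mono:
  assumes "2 \<le> r" "t \<le> m"
  shows "(t choose r) * (m choose 2) \<le> (m choose r) * (t choose 2)"
proof (cases "r \<le> t")
  case True
  have eq: "(n choose r) * (r choose 2) = (n choose 2) * ((n - 2) choose (r - 2))" if "r \<le> n" for n
    using choose_mult[of 2 r n] assms that by simp
  have "(t - 2) choose (r - 2) \<le> (m - 2) choose (r - 2)"
    using assms by (intro binomial_right_mono) simp
  have "(r choose 2) * ((t choose r) * (m choose 2)) = (t choose 2) * (m choose 2) * ((t - 2) choose (r - 2))"
    using eq[OF True] by (metis (no_types, lifting) mult.assoc mult.commute)
  also have "\<dots> \<le> (t choose 2) * (m choose 2) * ((m - 2) choose (r - 2))"
    by (rule mult_left_mono) (fact, simp)
  also have "\<dots> = (r choose 2) * ((m choose r) * (t choose 2))"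
    using eq[of m] True assms(2) by (metis (no_types, lifting) mult.assoc mult.commute order.trans)
  finally show ?thesis
    using assms(1) by simp
qed (simp add: binomial_eq_0)

text \<open>
  The total charge to a vertex that has \<open>x\<close> neighbours inside a set \<open>S\<close> and \<open>y\<close> neighbours outside,
  all of them mutually adjacent, when each \<open>r\<close>-clique is shared evenly among its vertices in \<open>S\<close>.
  For \<open>r \<ge> 1\<close> it is the average of \<open>i choose (r - 1)\<close> over \<open>i \<in> {y..x + y}\<close>.
\<close>

definition share :: "nat \<Rightarrow> nat \<Rightarrow> nat \<Rightarrow> real" where
  "share r x y = (real (x + y + 1 choose r) - real (y choose r)) / (real x + 1)"

lemma choose_diff_eq_sum:
  "real (Suc (x + y) choose Suc s) - real (y choose Suc s) = (\<Sum>i=y..x + y. real (i choose s))"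
  by (induction x) simp_all

text \<open>
  The interval \<open>{y..x + y}\<close> has centre \<open>x/2 + y\<close>. For \<open>y \<ge> 1\<close>, extended symmetrically, it becomes
  \<open>{1..x + 2y - 1}\<close>, over which the average of \<open>i choose (r - 1)\<close> is
  \<open>((x + 2y) choose r) / (x + 2y - 1)\<close>; monotonicity of the quotient above then compares with \<open>m\<close>.
  For \<open>r = 2 \<le> m\<close> the factor is \<open>1\<close> and the bound is an equality.
\<close>

lemma share_le:
  assumes "2 \<le> r" "x + 2 * y \<le> m" "x + 1 \<le> m"
  shows "share r x y \<le> real (m choose r) / real (m choose 2) * (real x / 2 + real y)"
proof (cases "m = 1")
  case True
  then have "x = 0" "y = 0" using assms by auto
  then show ?thesis using assms True by (simp add: share_def binomial_eq_0)
next
  case False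
  define q where "q = real (m choose r) / real (m choose 2)"
  have "2 \<le> m" using assms False by simp
  then have pos: "real (m choose 2) > 0" by simp
  have q: "real (t choose r) \<le> q * (real t * (real t - 1) / 2)" if "t \<le> m" for t
  proof -
    have "2 * (t choose 2) = t * (t - 1)"
      using times_binomial_minus1_eq[of 2 t] by simp
    then have "2 * real (t choose 2) = real t * real (t - 1)"
      by (metis of_nat_mult of_nat_numeral)
    then have "real (t choose 2) = real t * (real t - 1) / 2"
      by (cases t) auto
    moreover have "real (t choose r) * real (m choose 2) \<le> real (m choose r) * real (t choose 2)"
      using choose_ratio_mono[OF assms(1) that] by (metis of_nat_le_iff of_nat_mult)
    then have "real (t choose r) \<le> q * real (t choose 2)"
      using pos by (simp add: q_def field_simps)
    ultimately show ?thesis by metis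
  qed
  have "share r x y \<le> q * (real x / 2 + real y)"
  \<comment> \<open>For \<open>y = 0\<close> the interval starts at \<open>0\<close>, and the average is already of the required shape.\<close>
  proof (cases y)
    case 0
    then show ?thesis
      using q[OF assms(3)] assms(1) by (simp add: share_def field_simps)
  next
    case (Suc y')
    obtain s where s: "r = Suc s" "1 \<le> s" using assms(1) by (cases r) auto
    define z where "z = x + 2 * y"
    have z: "real z - 1 > 0" using Suc by (simp add: z_def)
    have "(\<Sum>i=1..z - 1. i choose s) = (\<Sum>i\<le>z - 1. i choose s)"
      using s by (intro sum.mono_neutral_left) auto
    also have "\<dots> = z choose r"
      using sum_choose_upper[of s "z - 1"] Suc s by (simp add: z_def)
    finally have *: "(\<Sum>i=1..z - 1. i choose s) = z choose r" .
    have "(z - 1) * (\<Sum>i=y..x + y. i choose s) \<le> (x + 1) * (z choose r)"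
      using average_choose_le[of y "x + y" s] Suc unfolding *[symmetric]
      by (simp add: z_def mult_2 add.left_commute add.commute)
    then have "real (z - 1) * real (\<Sum>i=y..x + y. i choose s) \<le> real (x + 1) * real (z choose r)"
      by (metis of_nat_le_iff of_nat_mult)
    then have "(real z - 1) * (share r x y * (real x + 1)) \<le> (real x + 1) * real (z choose r)"
      using choose_diff_eq_sum[of x y s] z s(1) by (simp add: share_def of_nat_diff add.commute)
    then have "((real z - 1) * share r x y) * (real x + 1) \<le> real (z choose r) * (real x + 1)"
      by (simp only: mult_ac)
    then have "(real z - 1) * share r x y \<le> real (z choose r)"
      by (rule mult_right_le_imp_le) simp
    also have "\<dots> \<le> (real z - 1) * (q * (real z / 2))"
      using q[of z] assms(2) by (simp add: z_def algebra_simps)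
    finally show ?thesis using z by (simp add: z_def add_divide_distrib)
  qed
  then show ?thesis by (simp add: q_def)
qed

lemma choose_two_le:
  assumes "2 \<le> r" "r + 2 \<le> m"
  shows "m choose 2 \<le> m choose r"
proof (cases "2 * r \<le> m")
  case True
  then show ?thesis using assms by (intro binomial_mono) auto
next
  case False
  then have "m choose 2 \<le> m choose (m - r)" using assms by (intro binomial_mono) auto
  then show ?thesis using assms binomial_symmetric[of r m] by simp
qed

text \<open>
  The sets \<open>L\<close> stand for the \<open>(s + 1)\<close>-cliques through a fixed vertex of \<open>S\<close> with that vertex removed,
  which is why the weight has \<open>1\<close> added to the size of the part in \<open>X\<close>. Both sides obey Pascal's
  rule when a vertex is added to \<open>Y\<close>.
\<close>

lemma sum_subsets_share:
  assumes "finite X" "finite Y" "X \<inter> Y = {}"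
  shows "(\<Sum>L | L \<subseteq> X \<union> Y \<and> card L = s. 1 / (real (card (L \<inter> X)) + 1))
    = share (Suc s) (card X) (card Y)"
  using assms(2,3)
proof (induction Y arbitrary: s rule: finite_induct)
  case empty
  have "(\<Sum>L | L \<subseteq> X \<union> {} \<and> card L = s. 1 / (real (card (L \<inter> X)) + 1))
      = (\<Sum>L | L \<subseteq> X \<and> card L = s. 1 / (real s + 1))"
    by (rule sum.cong) (auto simp: Int_absorb2)
  also have "\<dots> = real (card X choose s) / (real s + 1)"
    using n_subsets[OF assms(1), of s] by simp
  also have "\<dots> = real (Suc (card X) choose Suc s) / (real (card X) + 1)"
  proof -
    have "real (Suc (card X)) * real (card X choose s) = real (Suc (card X) choose Suc s) * real (Suc s)"
      using Suc_times_binomial_eq[of "card X" s] by (metis of_nat_mult)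
    then show ?thesis by (simp add: field_simps)
  qed
  finally show ?case by (simp add: share_def)
next
  case (insert z Y)
  define g where "g L = 1 / (real (card (L \<inter> X)) + 1)" for L
  have IH: "(\<Sum>L | L \<subseteq> X \<union> Y \<and> card L = s. g L) = share (Suc s) (card X) (card Y)" for s
    using insert unfolding g_def by blast
  have fin: "finite (X \<union> Y)" using insert assms(1) by simp
  have z: "z \<notin> X \<union> Y" using insert by auto
  show ?case
  proof (cases s)
    case 0
    have "{L. L \<subseteq> X \<union> insert z Y \<and> card L = 0} = {{}}"
      using fin by (auto dest: finite_subset)
    then show ?thesis using 0 by (simp add: share_def)
  next
    case (Suc t)
    let ?A = "{L. L \<subseteq> X \<union> Y \<and> card L = s}" and ?B = "{L. L \<subseteq> X \<union> Y \<and> card L = t}"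
    have "{L. L \<subseteq> X \<union> insert z Y \<and> card L = s} = ?A \<union> insert z ` ?B"
    proof (intro equalityI subsetI)
      fix L assume L: "L \<in> {L. L \<subseteq> X \<union> insert z Y \<and> card L = s}"
      show "L \<in> ?A \<union> insert z ` ?B"
      proof (cases "z \<in> L")
        case True
        then have "L = insert z (L - {z})" "L - {z} \<in> ?B" using L Suc by auto
        then show ?thesis by blast
      next
        case False
        then show ?thesis using L by auto
      qed
    next
      fix L assume "L \<in> ?A \<union> insert z ` ?B"
      then show "L \<in> {L. L \<subseteq> X \<union> insert z Y \<and> card L = s}"
      proof
        assume "L \<in> insert z ` ?B"
        then obtain L' where L': "L = insert z L'" "L' \<in> ?B" by blast
        then have "finite L'" "z \<notin> L'" using fin z by (auto dest: finite_subset)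
        then show ?thesis using L' Suc by auto
      qed auto
    qed
    moreover have "?A \<inter> insert z ` ?B = {}" using z by blast
    moreover have "inj_on (insert z) ?B" using z by (auto simp: inj_on_def)
    moreover have "g (insert z L) = g L" for L
      using z by (simp add: g_def)
    ultimately have "(\<Sum>L | L \<subseteq> X \<union> insert z Y \<and> card L = s. g L) = sum g ?A + sum g ?B"
      using fin by (simp add: sum.union_disjoint sum.reindex)
    also have "\<dots> = share (Suc s) (card X) (card Y) + share s (card X) (card Y)"
      using IH[of s] IH[of t] Suc by simp
    also have "\<dots> = share (Suc s) (card X) (card (insert z Y))"
      using insert(1,2) by (simp add: share_def Suc flip: add_divide_distrib)
    finally show ?thesis by (simp add: g_def)
  qed
qed

section \<open>A removable set of vertices in a graph without long cycles\<close>

definition path :: "'a set set \<Rightarrow> 'a set \<Rightarrow> 'a list \<Rightarrow> bool" where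
  "path E W p \<longleftrightarrow> distinct p \<and> set p \<subseteq> W \<and> successively (\<lambda>u v. {u, v} \<in> E) p"

definition cycle :: "'a set set \<Rightarrow> 'a list \<Rightarrow> bool" where
  "cycle E p \<longleftrightarrow> distinct p \<and> 3 \<le> length p \<and> successively (\<lambda>u v. {u, v} \<in> E) p \<and> {last p, hd p} \<in> E"

definition nbrs :: "'a set set \<Rightarrow> 'a set \<Rightarrow> 'a \<Rightarrow> 'a set" where
  "nbrs E W v = {u \<in> W. u \<noteq> v \<and> {u, v} \<in> E}"

text \<open>
  A neighbour off the path would extend it, and a neighbour at position \<open>j \<ge> 2\<close> closes a cycle of
  length \<open>j + 1\<close>.
\<close>

lemma nbrs_of_longest_path_start:
  assumes "path E W p" "p \<noteq> []" "\<And>q. path E W q \<Longrightarrow> length q \<le> length p"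
    and "\<And>q. cycle E q \<Longrightarrow> length q \<le> m" "2 \<le> m" "w \<in> nbrs E W (hd p)"
  obtains j where "w = p ! j" "0 < j" "j < length p" "j < m"
proof -
  have w: "w \<in> W" "w \<noteq> hd p" "{w, hd p} \<in> E" using assms(6) by (auto simp: nbrs_def)
  have "w \<in> set p"
  proof (rule ccontr)
    assume "w \<notin> set p"
    then have "path E W (w # p)"
      using assms(1,2) w by (auto simp: path_def successively_Cons)
    from assms(3)[OF this] show False by simp
  qed
  then obtain j where j: "w = p ! j" "j < length p" by (metis in_set_conv_nth)
  have "0 < j" using j w(2) assms(2) by (cases j) (auto simp: hd_conv_nth)
  have "j < m"
  proof (cases "j = 1")
    case False
    have "successively (\<lambda>u v. {u, v} \<in> E) (take (Suc j) p @ drop (Suc j) p)"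
      using assms(1) by (simp add: path_def)
    then have "successively (\<lambda>u v. {u, v} \<in> E) (take (Suc j) p)"
      unfolding successively_append_iff by blast
    moreover have "last (take (Suc j) p) = w" using j by (simp add: take_Suc_conv_app_nth)
    ultimately have "cycle E (take (Suc j) p)"
      using False \<open>0 < j\<close> j w assms(1) by (auto simp: cycle_def path_def)
    from assms(4)[OF this] show ?thesis using j by simp
  qed (use assms(5) in simp)
  with j \<open>0 < j\<close> that show thesis by blast
qed

lemma path_rotation:
  assumes "path E W (a @ b)" "a \<noteq> []" "b \<noteq> []" "{hd a, hd b} \<in> E"
  shows "path E W (rev a @ b)"
proof -
  have "successively (\<lambda>x y. {y, x} \<in> E) a = successively (\<lambda>x y. {x, y} \<in> E) a"
    by (simp only: insert_commute)
  then show ?thesis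
    using assms by (auto simp: path_def successively_append_iff last_rev)
qed

text \<open>
  The set \<open>S\<close> consists of the starts of the longest paths that arise by one rotation of a longest
  path \<open>p\<close>. Choosing \<open>p\<close> with a start of maximum degree \<open>d\<close> gives \<open>|S| = d\<close> and degrees at most \<open>d\<close>
  in \<open>S\<close>. A rotation happens within the first \<open>m\<close> vertices, so it leaves the set \<open>T\<close> of these
  vertices unchanged, and \<open>T\<close> contains the neighbours of every rotated start.
\<close>

lemma removable_set:
  assumes "finite W" "u \<in> W" "v \<in> W" "u \<noteq> v" "{u, v} \<in> E"
    and "\<And>q. cycle E q \<Longrightarrow> length q \<le> m" "2 \<le> m"
  obtains S T where "S \<noteq> {}" "S \<subset> W" "S \<subseteq> T" "T \<subseteq> W" "card T \<le> m"
    "\<And>x. x \<in> S \<Longrightarrow> nbrs E W x \<subseteq> T" "\<And>x. x \<in> S \<Longrightarrow> card (nbrs E W x) \<le> card S"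
proof -
  have bound: "length q \<le> card W" if "path E W q" for q
    using that assms(1) by (metis card_mono distinct_card path_def)
  have start: "path E W [u, v]" using assms(2-5) by (simp add: path_def)
  obtain p0 where p0: "path E W p0" "\<And>q. path E W q \<Longrightarrow> length q \<le> length p0"
    using ex_has_greatest_nat[of "path E W" "[u, v]" length "Suc (card W)"] start bound
    by (auto simp: less_Suc_eq_le)
  define l where "l = length p0"
  have l: "2 \<le> l" using p0(2)[OF start] by (simp add: l_def)
  let ?longest = "\<lambda>q. path E W q \<and> length q = l"
  let ?deg = "\<lambda>q. card (nbrs E W (hd q))"
  have "\<forall>q. ?longest q \<longrightarrow> ?deg q < Suc (card W)"
    using assms(1) by (auto simp: nbrs_def less_Suc_eq_le intro: card_mono)
  then obtain p where p: "?longest p" "\<And>q. ?longest q \<Longrightarrow> ?deg q \<le> ?deg p"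
    using ex_has_greatest_nat[of ?longest p0 ?deg "Suc (card W)"] p0(1) l_def by blast
  have start_nbr: "\<exists>j. w = q ! j \<and> 0 < j \<and> j < l \<and> j < m"
    if "?longest q" "w \<in> nbrs E W (hd q)" for q w
    using nbrs_of_longest_path_start[of E W q m w] that p0(2) assms(6,7) l unfolding l_def
    by (metis list.size(3) not_numeral_le_zero)
  have start_nbrs: "nbrs E W (hd q) \<subseteq> set (take m q)" if "?longest q" for q
    using start_nbr[OF that] that by (force simp: in_set_conv_nth)
  have dist: "distinct p" "set p \<subseteq> W" using p(1) by (auto simp: path_def)
  define J where "J = {j. 0 < j \<and> j < l \<and> j < m \<and> p ! j \<in> nbrs E W (hd p)}"
  define S where "S = (\<lambda>j. p ! (j - 1)) ` J"
  have "(!) p ` J = nbrs E W (hd p)"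
    using start_nbr[OF p(1)] unfolding J_def by blast
  moreover have "inj_on ((!) p) J"
    using dist p(1) by (auto simp: inj_on_def J_def nth_eq_iff_index_eq)
  moreover have "inj_on (\<lambda>j. p ! (j - 1)) J"
    using dist p(1) by (auto simp: inj_on_def J_def nth_eq_iff_index_eq)
  ultimately have card_S: "card S = card (nbrs E W (hd p))"
    unfolding S_def by (metis card_image)
  have S_nbrs: "nbrs E W x \<subseteq> set (take m p) \<and> card (nbrs E W x) \<le> card S" if "x \<in> S" for x
  proof -
    from that obtain j where j: "x = p ! (j - 1)" "0 < j" "j < l" "j < m" "p ! j \<in> nbrs E W (hd p)"
      by (auto simp: S_def J_def)
    define q where "q = rev (take j p) @ drop j p"
    have "{hd (take j p), hd (drop j p)} \<in> E"
      using j p(1) by (simp add: nbrs_def insert_commute hd_drop_conv_nth)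
    then have "?longest q"
      using path_rotation[of E W "take j p" "drop j p"] p(1) j
      by (cases "p = []") (auto simp: q_def)
    moreover have "hd q = x"
    proof -
      have "last (take j p) = p ! (j - 1)"
        using j p(1) by (subst last_conv_nth) (auto simp: min_def)
      then show ?thesis using j p(1) by (auto simp: q_def hd_append hd_rev)
    qed
    moreover have "set (take m q) = set (take m p)"
    proof -
      have "take m p = take j p @ take (m - j) (drop j p)"
        using j(4) by (metis le_add_diff_inverse less_imp_le take_add)
      then show ?thesis using j p(1) by (simp add: q_def)
    qed
    ultimately show ?thesis using start_nbrs[of q] p(2)[of q] card_S by auto
  qed
  \<comment> \<open>The second vertex of the path is a neighbour of the first, so the start itself is in \<open>S\<close>.\<close>
  have "1 \<in> J"
  proof -
    obtain a b p' where "p = a # b # p'"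
      using p(1) l by (metis Suc_le_length_iff numeral_2_eq_2)
    then show ?thesis using p(1) l assms(7)
      by (auto simp: J_def nbrs_def path_def insert_commute)
  qed
  \<comment> \<open>Predecessors are never the last vertex, which makes \<open>S\<close> a proper subset.\<close>
  moreover have "last p \<notin> S"
  proof
    assume "last p \<in> S"
    then obtain j where "last p = p ! (j - 1)" "0 < j" "j < l" by (auto simp: S_def J_def)
    moreover have "last p = p ! (l - 1)" using p(1) l by (subst last_conv_nth) auto
    ultimately show False using dist p(1) by (auto simp: nth_eq_iff_index_eq)
  qed
  moreover have "last p \<in> W" using dist p(1) l by (cases p rule: rev_cases) auto
  moreover have "S \<subseteq> set (take m p)"
  proof
    fix x assume "x \<in> S"
    then obtain j where "x = p ! (j - 1)" "0 < j" "j < l" "j < m" by (auto simp: S_def J_def)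
    then have "x = take m p ! (j - 1)" "j - 1 < length (take m p)" using p(1) by auto
    then show "x \<in> set (take m p)" by (metis nth_mem)
  qed
  moreover have "set (take m p) \<subseteq> W" using dist set_take_subset by fastforce
  moreover have "card (set (take m p)) \<le> m"
    using card_length[of "take m p"] by simp
  ultimately show thesis
    using that[of S "set (take m p)"] S_nbrs by (auto simp: S_def)
qed

section \<open>Counting coloured cliques\<close>

text \<open>
  For \<open>s = 2\<close> the cliques are the edges themselves, so red edges and blue \<open>r\<close>-cliques are counted by
  the same function.
\<close>

definition cliques :: "'a set set \<Rightarrow> 'a set \<Rightarrow> nat \<Rightarrow> 'a set set" where
  "cliques B W s = {K. K \<subseteq> W \<and> card K = s \<and> (\<forall>e\<subseteq>K. card e = 2 \<longrightarrow> e \<in> B)}"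

text \<open>
  Each set that meets \<open>S\<close> distributes a total weight of \<open>1\<close> evenly over its elements in \<open>S\<close>.
\<close>

lemma card_meeting_eq_sum:
  assumes "finite F" "finite S"
  shows "real (card {K \<in> F. K \<inter> S \<noteq> {}}) = (\<Sum>v\<in>S. \<Sum>K | K \<in> F \<and> v \<in> K. 1 / real (card (K \<inter> S)))"
proof -
  have "(\<Sum>v\<in>S. \<Sum>K | K \<in> F \<and> v \<in> K. 1 / real (card (K \<inter> S)))
      = (\<Sum>K\<in>F. \<Sum>v | v \<in> S \<and> v \<in> K. 1 / real (card (K \<inter> S)))"
    using assms sum.swap_restrict[of S F "\<lambda>v K. 1 / real (card (K \<inter> S))" "\<lambda>v K. v \<in> K"] by simp
  also have "\<dots> = (\<Sum>K\<in>F. if K \<inter> S \<noteq> {} then 1 else 0)"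
  proof (rule sum.cong)
    fix K assume "K \<in> F"
    have "{v \<in> S. v \<in> K} = K \<inter> S" by blast
    then show "(\<Sum>v | v \<in> S \<and> v \<in> K. 1 / real (card (K \<inter> S))) = (if K \<inter> S \<noteq> {} then 1 else 0)"
      using assms(2) by (auto simp: card_eq_0_iff)
  qed simp
  also have "\<dots> = real (card {K \<in> F. K \<inter> S \<noteq> {}})"
    using assms(1) by (simp add: sum.If_cases Int_def)
  finally show ?thesis by simp
qed

text \<open>
  Removing \<open>v\<close> maps the cliques through \<open>v\<close> injectively to sets of neighbours of \<open>v\<close>; the worst case
  is that all of these sets occur.
\<close>

lemma clique_share_le:
  assumes "finite W" "S \<subseteq> W" "v \<in> S"
  shows "(\<Sum>K | K \<in> cliques B W (Suc s) \<and> v \<in> K. 1 / real (card (K \<inter> S)))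
    \<le> share (Suc s) (card (nbrs B W v \<inter> S)) (card (nbrs B W v - S))"
proof -
  define X where "X = nbrs B W v \<inter> S"
  define Y where "Y = nbrs B W v - S"
  define g where "g L = 1 / (real (card (L \<inter> X)) + 1)" for L
  let ?F = "{K. K \<in> cliques B W (Suc s) \<and> v \<in> K}"
  have XY: "X \<union> Y = nbrs B W v" by (auto simp: X_def Y_def)
  have fin: "finite X" "finite Y" using assms(1) by (auto simp: X_def Y_def nbrs_def)
  have K: "K - {v} \<subseteq> X \<union> Y \<and> card (K - {v}) = s \<and> g (K - {v}) = 1 / real (card (K \<inter> S))"
    if "K \<in> ?F" for K
  proof -
    have cl: "K \<subseteq> W" "card K = Suc s" "\<And>e. e \<subseteq> K \<Longrightarrow> card e = 2 \<Longrightarrow> e \<in> B" "v \<in> K"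
      using that by (auto simp: cliques_def)
    have finK: "finite K" using cl(1) assms(1) finite_subset by blast
    have sub: "K - {v} \<subseteq> nbrs B W v"
    proof
      fix u assume u: "u \<in> K - {v}"
      then have "{u, v} \<in> B" using cl(4) by (intro cl(3)) auto
      then show "u \<in> nbrs B W v" using u cl(1) by (auto simp: nbrs_def)
    qed
    have "K \<inter> S = insert v ((K - {v}) \<inter> X)"
      using sub cl(4) assms(3) by (auto simp: X_def)
    then have "card (K \<inter> S) = Suc (card ((K - {v}) \<inter> X))"
      using finK by simp
    then show ?thesis using sub cl finK by (simp add: XY g_def add.commute)
  qed
  have "(\<Sum>K\<in>?F. 1 / real (card (K \<inter> S))) = (\<Sum>K\<in>?F. g (K - {v}))"
    using K by (intro sum.cong) auto
  also have "\<dots> = sum g ((\<lambda>K. K - {v}) ` ?F)"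
    by (subst sum.reindex) (auto simp: inj_on_def)
  also have "\<dots> \<le> (\<Sum>L | L \<subseteq> X \<union> Y \<and> card L = s. g L)"
    using K fin by (intro sum_mono2) (auto simp: g_def)
  also have "\<dots> = share (Suc s) (card X) (card Y)"
    unfolding g_def using fin by (intro sum_subsets_share) (auto simp: X_def Y_def)
  finally show ?thesis by (simp add: X_def Y_def)
qed

lemma finite_cliques: "finite W \<Longrightarrow> finite (cliques B W s)"
  by (rule finite_subset[of _ "Pow W"]) (auto simp: cliques_def)

lemma card_cliques_le:
  assumes "finite W" "S \<subseteq> W" "0 < s"
  shows "real (card (cliques B W s)) \<le> real (card (cliques B (W - S) s))
    + (\<Sum>v\<in>S. share s (card (nbrs B W v \<inter> S)) (card (nbrs B W v - S)))"
proof -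
  obtain t where t: "s = Suc t" using assms(3) by (cases s) auto
  have finS: "finite S" using assms finite_subset by blast
  let ?M = "{K \<in> cliques B W s. K \<inter> S \<noteq> {}}"
  have "cliques B W s = cliques B (W - S) s \<union> ?M"
    by (auto simp: cliques_def)
  moreover have "card (cliques B (W - S) s \<union> ?M) = card (cliques B (W - S) s) + card ?M"
    using assms(1) by (intro card_Un_disjoint) (auto simp: finite_cliques, auto simp: cliques_def)
  ultimately have "card (cliques B W s) = card (cliques B (W - S) s) + card ?M"
    by (rule ssubst[where P = "\<lambda>C. card C = _"])
  moreover have "real (card ?M) \<le> (\<Sum>v\<in>S. share s (card (nbrs B W v \<inter> S)) (card (nbrs B W v - S)))"
    unfolding card_meeting_eq_sum[OF finite_cliques[OF assms(1)] finS] t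
    using clique_share_le[OF assms(1,2)] by (intro sum_mono)
  ultimately show ?thesis by simp
qed

lemma cliques_empty:
  assumes "finite W" "2 \<le> s" "\<And>u v. u \<in> W \<Longrightarrow> v \<in> W \<Longrightarrow> u \<noteq> v \<Longrightarrow> {u, v} \<notin> B"
  shows "cliques B W s = {}"
proof -
  have False if "K \<in> cliques B W s" for K
  proof -
    have K: "K \<subseteq> W" "2 \<le> card K" "\<And>e. e \<subseteq> K \<Longrightarrow> card e = 2 \<Longrightarrow> e \<in> B"
      using that assms(2) by (auto simp: cliques_def)
    obtain e where e: "e \<subseteq> K" "card e = 2" using obtain_subset_with_card_n[OF K(2)] by blast
    then obtain u v where "e = {u, v}" "u \<noteq> v" by (auto simp: card_2_iff)
    then show False using assms(3) K(1) K(3)[OF e] e(1) by auto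
  qed
  then show ?thesis by blast
qed

text \<open>
  Deleting the set \<open>S\<close> from \<open>removable_set\<close> destroys at most \<open>(m choose r) / (m - 1)\<close> objects per
  vertex, and a graph with short cycles only keeps this property. As \<open>S\<close> is a proper subset, the
  deletions end in a nonempty edgeless set, which accounts for the term \<open>- 1\<close>.
\<close>

lemma coloured_clique_bound:
  assumes "2 \<le> r" "r + 2 \<le> m" "R \<inter> B = {}" "\<And>q. cycle (R \<union> B) q \<Longrightarrow> length q \<le> m"
    and "finite W" "W \<noteq> {}"
  shows "real (card (cliques R W 2)) + real (card (cliques B W r))
    \<le> real (m choose r) / (real m - 1) * (real (card W) - 1)"
  using assms(5,6)
proof (induction W rule: finite_psubset_induct)
  case (psubset W)
  define a where "a = real (m choose r) / (real m - 1)"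
  have a: "a \<ge> 0" using assms(1,2) by (simp add: a_def)
  have W: "real (card W) - 1 \<ge> 0" using psubset by (simp add: Suc_le_eq card_gt_0_iff)
  show ?case
  proof (cases "\<exists>u\<in>W. \<exists>v\<in>W. u \<noteq> v \<and> {u, v} \<in> R \<union> B")
    case False
    then have "cliques R W 2 = {}" "cliques B W r = {}"
      using assms(1) psubset.hyps by (intro cliques_empty; blast; fail)+
    then show ?thesis using mult_nonneg_nonneg[OF a W] by (simp add: a_def)
  next
    case True
    then obtain u v where uv: "u \<in> W" "v \<in> W" "u \<noteq> v" "{u, v} \<in> R \<union> B" by blast
    obtain S T where ST: "S \<noteq> {}" "S \<subset> W" "S \<subseteq> T" "T \<subseteq> W" "card T \<le> m"
      "\<And>x. x \<in> S \<Longrightarrow> nbrs (R \<union> B) W x \<subseteq> T" "\<And>x. x \<in> S \<Longrightarrow> card (nbrs (R \<union> B) W x) \<le> card S"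
      using removable_set[OF psubset.hyps(1) uv assms(4)] assms(1,2) by auto
    have fin: "finite S" "finite T" using ST psubset.hyps(1) by (auto intro: finite_subset)
    have vertex: "share 2 (card (nbrs R W v \<inter> S)) (card (nbrs R W v - S))
        + share r (card (nbrs B W v \<inter> S)) (card (nbrs B W v - S)) \<le> a" if "v \<in> S" for v
    proof -
      let ?x1 = "card (nbrs R W v \<inter> S)" and ?y1 = "card (nbrs R W v - S)"
      let ?x2 = "card (nbrs B W v \<inter> S)" and ?y2 = "card (nbrs B W v - S)"
      let ?N = "nbrs (R \<union> B) W v"
      define q where "q = real (m choose r) / real (m choose 2)"
      have N: "?N = nbrs R W v \<union> nbrs B W v" "nbrs R W v \<inter> nbrs B W v = {}"
        using assms(3) by (auto simp: nbrs_def)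
      have finN: "finite (nbrs C W v)" for C using psubset.hyps(1) by (simp add: nbrs_def)
      have "?N \<inter> S = (nbrs R W v \<inter> S) \<union> (nbrs B W v \<inter> S)"
        "(nbrs R W v \<inter> S) \<inter> (nbrs B W v \<inter> S) = {}"
        using N by blast+
      then have x: "card (?N \<inter> S) = ?x1 + ?x2"
        using finN by (metis card_Un_disjoint finite_Int)
      have "?N - S = (nbrs R W v - S) \<union> (nbrs B W v - S)"
        "(nbrs R W v - S) \<inter> (nbrs B W v - S) = {}"
        using N by blast+
      then have y: "card (?N - S) = ?y1 + ?y2"
        using finN by (metis card_Un_disjoint finite_Diff)
      have "card ?N = card (?N \<inter> S) + card (?N - S)"
        using finN by (rule card_Int_Diff)
      then have xy: "?x1 + ?x2 + (?y1 + ?y2) \<le> card S" using x y ST(7)[OF that] by simp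
      have "card (?N - S) \<le> card (T - S)"
        using ST(6)[OF that] fin by (intro card_mono) auto
      then have "?y1 + ?y2 + card S \<le> m"
        using y ST(3,5) fin card_mono[OF fin(2) ST(3)] by (simp add: card_Diff_subset)
      \<comment> \<open>Adding both bounds: \<open>x + y \<le> |S|\<close> by the degree bound, \<open>y \<le> m - |S|\<close> as neighbours lie in \<open>T\<close>.\<close>
      with xy have xyy: "?x1 + ?x2 + 2 * (?y1 + ?y2) \<le> m" by simp
      have "card (?N \<inter> S) < card S"
        using that fin by (intro psubset_card_mono) (auto simp: nbrs_def)
      then have xm: "?x1 + ?x2 + 1 \<le> m" using x ST(3,5) card_mono[OF fin(2) ST(3)] by simp
      have "real (m choose 2) > 0" using assms by simp
      moreover have "real (m choose 2) \<le> real (m choose r)" using choose_two_le[OF assms(1,2)] by simp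
      ultimately have q: "1 \<le> q" by (simp add: q_def)
      have "share 2 ?x1 ?y1 \<le> real ?x1 / 2 + real ?y1"
        using share_le[of 2 ?x1 ?y1 m] xyy xm \<open>real (m choose 2) > 0\<close> by simp
      also have "\<dots> \<le> q * (real ?x1 / 2 + real ?y1)"
        using mult_right_mono[OF q, of "real ?x1 / 2 + real ?y1"] by simp
      finally have "share 2 ?x1 ?y1 \<le> q * (real ?x1 / 2 + real ?y1)" .
      moreover have "share r ?x2 ?y2 \<le> q * (real ?x2 / 2 + real ?y2)"
        using share_le[of r ?x2 ?y2 m] xyy xm assms(1) by (simp add: q_def)
      ultimately have "share 2 ?x1 ?y1 + share r ?x2 ?y2
          \<le> q * (real (?x1 + ?x2 + 2 * (?y1 + ?y2)) / 2)"
        by (simp add: field_simps)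
      also have "\<dots> \<le> q * (real m / 2)"
      proof (rule mult_left_mono)
        show "real (?x1 + ?x2 + 2 * (?y1 + ?y2)) / 2 \<le> real m / 2"
          using xyy by (intro divide_right_mono of_nat_mono) auto
      qed (use q in simp)
      also have "\<dots> = a"
      proof -
        have "2 * (m choose 2) = m * (m - 1)"
          using times_binomial_minus1_eq[of 2 m] by simp
        then have "2 * real (m choose 2) = real m * real (m - 1)"
          by (metis of_nat_mult of_nat_numeral)
        then have "real (m choose 2) = real m * (real m - 1) / 2"
          by (cases m) auto
        then have "q * (real m / 2) = real (m choose r) / (real m * (real m - 1) / 2) * (real m / 2)"
          by (simp only: q_def)
        also have "\<dots> = a"
        proof -
          have "c / (x * y / 2) * (x / 2) = c / y" if "x \<noteq> 0" for c x y :: real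
            using that by simp
          then show ?thesis using assms(2) by (simp only: a_def)
        qed
        finally show ?thesis .
      qed
      finally show ?thesis .
    qed
    have "real (card (cliques R W 2)) + real (card (cliques B W r))
        \<le> real (card (cliques R (W - S) 2)) + real (card (cliques B (W - S) r))
          + (\<Sum>v\<in>S. share 2 (card (nbrs R W v \<inter> S)) (card (nbrs R W v - S))
                + share r (card (nbrs B W v \<inter> S)) (card (nbrs B W v - S)))"
      using card_cliques_le[of W S 2 R] card_cliques_le[of W S r B] psubset.hyps(1) psubset_imp_subset[OF ST(2)] assms(1)
      by (simp add: sum.distrib)
    also have "\<dots> \<le> a * (real (card (W - S)) - 1) + (\<Sum>v\<in>S. a)"
      using psubset.IH[of "W - S"] ST(1,2) unfolding a_def[symmetric]
      by (intro add_mono sum_mono vertex) auto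
    also have "\<dots> = a * (real (card W) - 1)"
    proof -
      have "real (card W) = real (card (W - S)) + real (card S)"
        using ST(2) fin psubset.hyps(1) card_mono[of W S] by (simp add: card_Diff_subset of_nat_diff)
      then show ?thesis by (simp add: algebra_simps)
    qed
    finally show ?thesis by (simp add: a_def)
  qed
qed

section \<open>Representing hyperedges by pairs\<close>

text \<open>
  Hall's marriage theorem. If some proper nonempty \<open>J\<close> is tight, then \<open>J\<close> and its complement can be
  matched independently, the latter avoiding everything that \<open>J\<close> can use. Otherwise there is room to
  match one index arbitrarily and remove its partner.
\<close>

lemma hall:
  assumes "finite I" "\<And>i. i \<in> I \<Longrightarrow> finite (F i)"
    and "\<And>J. J \<subseteq> I \<Longrightarrow> card J \<le> card (\<Union>(F ` J))"
  shows "\<exists>f. inj_on f I \<and> (\<forall>i\<in>I. f i \<in> F i)"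
  using assms
proof (induction I arbitrary: F rule: finite_psubset_induct)
  case (psubset I)
  have finU: "finite (\<Union>(F ` J))" if "J \<subseteq> I" for J
    using that psubset.hyps psubset.prems(1) by (auto intro: finite_subset)
  consider "I = {}" | (tight) J where "J \<noteq> {}" "J \<subset> I" "card J = card (\<Union>(F ` J))"
    | (slack) "I \<noteq> {}" "\<And>J. J \<noteq> {} \<Longrightarrow> J \<subset> I \<Longrightarrow> card J < card (\<Union>(F ` J))"
    using psubset.prems(2) by (metis le_neq_implies_less psubset_imp_subset)
  then show ?case
  proof cases
    case tight
    let ?U = "\<Union>(F ` J)"
    have "\<exists>f. inj_on f J \<and> (\<forall>i\<in>J. f i \<in> F i)"
      using tight(2) by (intro psubset.IH psubset.prems) auto
    moreover have "\<exists>g. inj_on g (I - J) \<and> (\<forall>i\<in>I - J. g i \<in> F i - ?U)"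
    proof (rule psubset.IH)
      show "I - J \<subset> I" using tight(1,2) by blast
      show "finite (F i - ?U)" if "i \<in> I - J" for i using that psubset.prems(1) by blast
      fix K assume K: "K \<subseteq> I - J"
      have fin: "finite J" "finite K"
        using K tight(2) psubset.hyps by (auto intro: finite_subset)
      have "J \<union> K \<subseteq> I" using K tight(2) by blast
      then have "card (J \<union> K) \<le> card (\<Union>(F ` (J \<union> K)))" by (rule psubset.prems(2))
      also have "\<Union>(F ` (J \<union> K)) = ?U \<union> (\<Union>i\<in>K. F i - ?U)" by blast
      also have "card \<dots> \<le> card ?U + card (\<Union>i\<in>K. F i - ?U)" by (rule card_Un_le)
      also have "card (J \<union> K) = card J + card K" using K fin by (intro card_Un_disjoint) auto
      finally show "card K \<le> card (\<Union>i\<in>K. F i - ?U)" using tight(3) by simp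
    qed
    ultimately obtain f g where fg: "inj_on f J" "\<And>i. i \<in> J \<Longrightarrow> f i \<in> F i"
      "inj_on g (I - J)" "\<And>i. i \<in> I - J \<Longrightarrow> g i \<in> F i - ?U" by blast
    let ?h = "\<lambda>i. if i \<in> J then f i else g i"
    have "f ` J \<subseteq> ?U" using fg(2) by (auto intro: UN_I)
    moreover have "g ` (I - J) \<inter> ?U = {}" using fg(4) by auto
    ultimately have "f ` J \<inter> g ` (I - J) = {}" by blast
    then have "inj_on ?h (J \<union> (I - J))" using fg(1,3) by (intro inj_on_disjoint_Un)
    moreover have "J \<union> (I - J) = I" using tight(2) by blast
    ultimately have "inj_on ?h I" by (simp only:)
    moreover have "\<forall>i\<in>I. ?h i \<in> F i" using fg(2,4) by auto
    ultimately show ?thesis by blast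
  next
    case slack
    obtain i where i: "i \<in> I" using slack(1) by blast
    have "card {i} \<le> card (\<Union>(F ` {i}))" using i by (intro psubset.prems(2)) simp
    then have "F i \<noteq> {}" by auto
    then obtain x where x: "x \<in> F i" by blast
    have "\<exists>f. inj_on f (I - {i}) \<and> (\<forall>j\<in>I - {i}. f j \<in> F j - {x})"
    proof (rule psubset.IH)
      show "I - {i} \<subset> I" using i by blast
      show "finite (F j - {x})" if "j \<in> I - {i}" for j using that psubset.prems(1) by blast
      fix J assume J: "J \<subseteq> I - {i}"
      show "card J \<le> card (\<Union>j\<in>J. F j - {x})"
      proof (cases "J = {}")
        case False
        then have "card J < card (\<Union>(F ` J))" using J i by (intro slack(2)) auto
        also have "card (\<Union>(F ` J)) \<le> Suc (card (\<Union>(F ` J) - {x}))"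
          unfolding card_Diff_singleton_if by (split if_split) arith
        also have "\<Union>(F ` J) - {x} = (\<Union>j\<in>J. F j - {x})" by blast
        finally show ?thesis by simp
      qed simp
    qed
    then obtain f where f: "inj_on f (I - {i})" "\<And>j. j \<in> I - {i} \<Longrightarrow> f j \<in> F j - {x}" by blast
    have "inj_on (f(i := x)) (insert i (I - {i}))"
      using f by (subst inj_on_insert) (auto simp: inj_on_def)
    moreover have "insert i (I - {i}) = I" using i by blast
    moreover have "\<forall>j\<in>I. (f(i := x)) j \<in> F j" using f(2) x by auto
    ultimately show ?thesis by metis
  qed simp
qed

definition pairs :: "'a set \<Rightarrow> 'a set set" where
  "pairs e = {p. p \<subseteq> e \<and> card p = 2}"

text \<open>
  The set \<open>A\<close> maximises the excess \<open>card A - card (N A)\<close>, where \<open>N A\<close> is the set of pairs covered by \<open>A\<close>.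
  Comparing \<open>A\<close> with a larger set \<open>A \<union> J\<close> gives Hall's condition for matching \<open>H - A\<close> to uncovered
  pairs; comparing it with its members that contain no pair of a set \<open>Q\<close> of covered pairs gives
  Hall's condition for matching covered pairs to \<open>A\<close>.
\<close>

lemma red_blue_representation:
  assumes "uniform_hypergraph r V H"
  shows "\<exists>R B f. R \<inter> B = {} \<and> inj_on f (R \<union> B) \<and> (\<forall>p\<in>R \<union> B. p \<subseteq> f p \<and> f p \<in> H)
    \<and> card H \<le> card (cliques R V 2) + card (cliques B V r)"
proof -
  have finV: "finite V" and edge: "\<And>e. e \<in> H \<Longrightarrow> e \<subseteq> V \<and> card e = r"
    using assms by (auto simp: uniform_hypergraph_def)
  have finH: "finite H" using finV edge by (intro finite_subset[of H "Pow V"]) auto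
  define N where "N A = \<Union>(pairs ` A)" for A :: "'a set set"
  have finpairs: "finite (pairs e)" if "e \<in> H" for e
  proof -
    have "finite e" using edge[OF that] finV by (blast intro: finite_subset)
    then show ?thesis by (simp add: pairs_def)
  qed
  have finN: "finite (N A)" if "A \<subseteq> H" for A
    unfolding N_def using that finH finpairs by (auto intro: finite_subset)
  define excess where "excess A = int (card A) - int (card (N A))" for A
  have "\<exists>A\<in>Pow H. \<forall>C\<in>Pow H. excess C \<le> excess A"
  proof -
    let ?D = "excess ` Pow H"
    have "Max ?D \<in> ?D" using finH by (intro Max_in) auto
    then obtain A where "A \<in> Pow H" "excess A = Max ?D" by auto
    then show ?thesis using finH by (metis Max_ge finite_Pow_iff finite_imageI imageI)
  qed
  then obtain A where A: "A \<subseteq> H" "\<And>C. C \<subseteq> H \<Longrightarrow> excess C \<le> excess A" by auto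
  have finA: "finite A" using A(1) finH finite_subset by blast
  define B where "B = N A"

  have "\<exists>g. inj_on g (H - A) \<and> (\<forall>e\<in>H - A. g e \<in> pairs e - B)"
  proof (rule hall)
    show "finite (H - A)" using finH by simp
    show "finite (pairs e - B)" if "e \<in> H - A" for e using that finpairs by simp
    fix J assume J: "J \<subseteq> H - A"
    have finJ: "finite J" using J finH by (auto intro: finite_subset)
    have "N (A \<union> J) = B \<union> (\<Union>e\<in>J. pairs e - B)" by (auto simp: N_def B_def)
    moreover have "finite (N (A \<union> J))" using finN A(1) J by (metis Diff_subset Un_least order.trans)
    ultimately have "card (N (A \<union> J)) = card B + card (\<Union>e\<in>J. pairs e - B)"
      by (simp only: finite_Un) (rule card_Un_disjoint, auto)
    moreover have "card (A \<union> J) = card A + card J"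
      using J finA finJ by (intro card_Un_disjoint) auto
    moreover have "excess (A \<union> J) \<le> excess A" using A(1) J by (intro A(2)) auto
    ultimately show "card J \<le> card (\<Union>e\<in>J. pairs e - B)" by (simp add: excess_def B_def)
  qed
  then obtain g where g: "inj_on g (H - A)" "\<And>e. e \<in> H - A \<Longrightarrow> g e \<in> pairs e - B" by blast

  have "\<exists>h. inj_on h B \<and> (\<forall>p\<in>B. h p \<in> {e \<in> A. p \<subseteq> e})"
  proof (rule hall)
    show "finite B" using finN[OF A(1)] by (simp add: B_def)
    show "finite {e \<in> A. p \<subseteq> e}" for p using finA by simp
    fix Q assume Q: "Q \<subseteq> B"
    let ?M = "\<Union>p\<in>Q. {e \<in> A. p \<subseteq> e}"
    have "N (A - ?M) \<subseteq> B - Q" by (auto simp: N_def B_def pairs_def)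
    then have "card (N (A - ?M)) \<le> card (B - Q)"
      using finN[OF A(1)] by (intro card_mono) (auto simp: B_def)
    moreover have "card (B - Q) + card Q = card B"
      using Q finN[OF A(1)] card_mono[of B Q]
      by (subst card_Diff_subset) (auto simp: B_def intro: finite_subset)
    moreover have "card (A - ?M) + card ?M = card A"
    proof -
      have "?M \<subseteq> A" by blast
      then show ?thesis using finA card_mono[of A ?M]
        by (subst card_Diff_subset) (auto intro: finite_subset)
    qed
    moreover have "excess (A - ?M) \<le> excess A" using A(1) by (intro A(2)) auto
    ultimately show "card Q \<le> card ?M" by (simp add: excess_def B_def)
  qed
  then obtain h where h: "inj_on h B" "\<And>p. p \<in> B \<Longrightarrow> h p \<in> A \<and> p \<subseteq> h p" by blast

  define R where "R = g ` (H - A)"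
  define f where "f p = (if p \<in> B then h p else inv_into (H - A) g p)" for p
  have disj: "R \<inter> B = {}" using g(2) by (auto simp: R_def)
  have fR: "f p \<in> H - A" "p \<in> pairs (f p)" if "p \<in> R" for p
  proof -
    obtain e where e: "e \<in> H - A" "p = g e" using \<open>p \<in> R\<close> unfolding R_def by blast
    then have "f p = e" using that disj g(1) by (auto simp: f_def)
    then show "f p \<in> H - A" "p \<in> pairs (f p)" using e g(2) by auto
  qed
  have fB: "f p \<in> A" "p \<subseteq> f p" if "p \<in> B" for p
    using that h(2) by (auto simp: f_def B_def N_def pairs_def)
  have "inj_on f R"
  proof -
    have "inj_on (inv_into (H - A) g) R" by (simp add: R_def inj_on_inv_into)
    then show ?thesis using disj by (auto simp: inj_on_def f_def)
  qed
  moreover have "inj_on f B" using h(1) by (auto simp: inj_on_def f_def)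
  moreover have "f ` R \<subseteq> H - A" "f ` B \<subseteq> A"
    by (intro image_subsetI fR(1) fB(1); assumption)+
  then have "f ` R \<inter> f ` B = {}" by blast
  ultimately have inj: "inj_on f (R \<union> B)" unfolding inj_on_Un by blast
  have "card R = card (H - A)" using g(1) by (simp add: R_def card_image)
  moreover have "card R \<le> card (cliques R V 2)"
  proof (rule card_mono)
    show "R \<subseteq> cliques R V 2"
    proof
      fix p assume p: "p \<in> R"
      have "p \<subseteq> V" "card p = 2" using fR[OF p] edge by (auto simp: pairs_def)
      moreover have "e = p" if "e \<subseteq> p" "card e = 2" for e
        using that \<open>card p = 2\<close> by (metis card_subset_eq card.infinite zero_neq_numeral)
      ultimately show "p \<in> cliques R V 2" using p by (auto simp: cliques_def)
    qed
  qed (rule finite_cliques[OF finV])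
  moreover have "card A \<le> card (cliques B V r)"
    using A(1) edge by (intro card_mono finite_cliques finV)
      (auto simp: cliques_def B_def N_def pairs_def)
  moreover have "card H = card A + card (H - A)"
    using A(1) finA finH card_mono[of H A] by (simp add: card_Diff_subset)
  ultimately have "card H \<le> card (cliques R V 2) + card (cliques B V r)" by simp
  moreover have "p \<subseteq> f p \<and> f p \<in> H" if "p \<in> R \<union> B" for p
  proof (cases "p \<in> B")
    case True
    then show ?thesis using fB[OF True] A(1) by blast
  next
    case False
    then show ?thesis using fR[of p] that by (auto simp: pairs_def)
  qed
  ultimately show ?thesis using disj inj by blast
qed

section \<open>Long cycles of representing pairs yield Berge paths\<close>

lemma successively_nth: "successively P xs \<Longrightarrow> Suc i < length xs \<Longrightarrow> P (xs ! i) (xs ! Suc i)"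
proof (induction xs arbitrary: i)
  case (Cons x xs)
  then show ?case by (cases i) (auto simp: successively_Cons hd_conv_nth)
qed simp

lemma cycle_nth:
  assumes "cycle E q" "i < length q"
  shows "{q ! i, q ! (Suc i mod length q)} \<in> E"
proof (cases "Suc i < length q")
  case True
  then show ?thesis using assms successively_nth[of "\<lambda>u v. {u, v} \<in> E" q i] by (simp add: cycle_def)
next
  case False
  then have i: "Suc i = length q" using assms(2) by simp
  moreover have "q \<noteq> []" using assms(2) by auto
  then have "q ! i = last q" "q ! 0 = hd q"
    using i[symmetric] by (simp_all add: last_conv_nth hd_conv_nth)
  ultimately show ?thesis using assms(1) by (simp add: cycle_def)
qed

lemma connected_crossing_edge:
  assumes "connected_hypergraph V H" "a \<in> V" "a \<in> X" "b \<in> V" "b \<notin> X"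
  obtains e u w where "e \<in> H" "u \<in> e" "w \<in> e" "u \<in> X" "w \<notin> X"
proof -
  have "(a, b) \<in> (two_shadow H)\<^sup>*" using assms by (simp add: connected_hypergraph_def)
  then have "b \<in> X \<or> (\<exists>e\<in>H. \<exists>u w. u \<in> e \<and> w \<in> e \<and> u \<in> X \<and> w \<notin> X)"
    by (induction rule: rtrancl_induct) (use assms(3) in \<open>auto simp: two_shadow_def\<close>)
  then show thesis using that assms(5) by blast
qed

text \<open>
  The representing hyperedges \<open>c i\<close> of the cycle edges are distinct. If the cycle has length exactly
  \<open>k\<close>, the missing vertex comes from a hyperedge \<open>e\<close> that contains a cycle vertex \<open>q ! s\<close> and some \<open>w\<close>
  off the cycle: the path is \<open>w\<close>, then \<open>e\<close>, then once around the cycle from position \<open>s\<close>. This omits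
  the cycle edge just before \<open>s\<close>, so \<open>e\<close> may be that edge's hyperedge but none of the others.
\<close>

lemma berge_path_of_long_cycle:
  assumes "uniform_hypergraph r V H" "connected_hypergraph V H" "k < card V"
    and "inj_on f E" "\<And>p. p \<in> E \<Longrightarrow> p \<subseteq> f p \<and> f p \<in> H"
    and "cycle E q" "k \<le> length q"
  shows "\<exists>vs es. berge_path V H k vs es"
proof -
  define l where "l = length q"
  define c where "c i = f {q ! i, q ! (Suc i mod l)}" for i
  have q: "distinct q" "3 \<le> l" using assms(6) by (auto simp: cycle_def l_def)
  have pair: "{q ! i, q ! (Suc i mod l)} \<in> E" if "i < l" for i
    using cycle_nth[OF assms(6)] that by (simp add: l_def)
  have c: "c i \<in> H" "q ! i \<in> c i" "q ! (Suc i mod l) \<in> c i" if "i < l" for i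
    using assms(5)[OF pair[OF that]] by (auto simp: c_def)
  have HV: "e \<subseteq> V" if "e \<in> H" for e using assms(1) that by (simp add: uniform_hypergraph_def)
  have qV: "set q \<subseteq> V" using c HV by (force simp: in_set_conv_nth l_def)
  have c_inj: "i = j" if "i < l" "j < l" "c i = c j" for i j
  proof -
    have eq: "{q ! i, q ! (Suc i mod l)} = {q ! j, q ! (Suc j mod l)}"
      using that assms(4) pair by (simp add: c_def inj_on_eq_iff)
    have lt: "Suc i mod l < l" "Suc j mod l < l" using q(2) by auto
    consider "q ! i = q ! j" | "q ! i = q ! (Suc j mod l)" "q ! (Suc i mod l) = q ! j"
      using eq by (auto simp: doubleton_eq_iff)
    then show ?thesis
    proof cases
      case 1
      then show ?thesis using q(1) that by (simp add: nth_eq_iff_index_eq l_def)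
    next
      case 2
      then have "i = Suc j mod l" "j = Suc i mod l"
        using q(1) that lt by (auto simp: nth_eq_iff_index_eq l_def)
      moreover have "Suc t mod l = (if Suc t = l then 0 else Suc t)" if "t < l" for t
        using that by simp
      ultimately show ?thesis using q(2) that by (auto split: if_splits)
    qed
  qed
  show ?thesis
  proof (cases "k < l")
    case True
    have "berge_path V H k (take (Suc k) q) (map c [0..<k])"
      unfolding berge_path_def
    proof (intro conjI allI impI)
      show "distinct (map c [0..<k])" using c_inj True by (auto simp: distinct_map inj_on_def)
      show "set (map c [0..<k]) \<subseteq> H" using c(1) True by auto
      show "{take (Suc k) q ! i, take (Suc k) q ! (i + 1)} \<subseteq> map c [0..<k] ! i" if "i < k" for i
        using c(2,3)[of i] that True by simp
    qed (use q(1) qV True set_take_subset[of "Suc k" q] in \<open>auto simp: l_def\<close>)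
    then show ?thesis by blast
  next
    case False
    then have l: "l = k" using assms(7) by (simp add: l_def)
    have "card (set q) < card V" using q(1) assms(3) l by (simp add: distinct_card l_def)
    then obtain b where b: "b \<in> V" "b \<notin> set q" using qV by (metis less_irrefl subsetI subset_antisym)
    have "hd q \<in> set q" using q(2) by (cases q) (auto simp: l_def)
    then obtain e u w where e: "e \<in> H" "u \<in> e" "w \<in> e" "u \<in> set q" "w \<notin> set q"
      using connected_crossing_edge[OF assms(2) _ _ b, of "hd q"] qV by blast
    obtain s where s: "s < l" "q ! s \<in> e" "\<And>i. i < k - 1 \<Longrightarrow> e \<noteq> c ((s + i) mod l)"
    \<comment> \<open>If \<open>e\<close> represents the cycle edge at \<open>i\<close>, start right after it, so that its edge is the omitted one.\<close>
    proof (cases "\<exists>i<l. e = c i")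
      case True
      then obtain i where i: "i < l" "e = c i" by blast
      show thesis
      proof (rule that[of "Suc i mod l"])
        show "Suc i mod l < l" using q(2) by simp
        show "q ! (Suc i mod l) \<in> e" using c(3) i by simp
        fix t assume t: "t < k - 1"
        have "(Suc i mod l + t) mod l \<noteq> i"
        proof
          assume "(Suc i mod l + t) mod l = i"
          then have "(i + Suc t) mod l = (i + 0) mod l" using i(1) by (simp add: mod_add_left_eq)
          then have "l dvd Suc t" by (metis add_left_cancel mod_eq_dvd_iff_nat le_add1 diff_add_inverse add_0_right)
          then show False using t l by (auto dest: dvd_imp_le)
        qed
        moreover have "(Suc i mod l + t) mod l < l" using q(2) by simp
        ultimately show "e \<noteq> c ((Suc i mod l + t) mod l)" using c_inj i by metis
      qed
    next
      case False
      obtain s where "s < l" "u = q ! s" using e(4) by (auto simp: in_set_conv_nth l_def)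
      moreover have "(s + i) mod l < l" for i using q(2) by simp
      ultimately show thesis using that[of s] False e(2) by blast
    qed
    have idx: "(s + i) mod l < l" for i using q(2) by simp
    have idx_inj: "i = j" if "(s + i) mod l = (s + j) mod l" "i < l" "j < l" for i j
      using that s(1) by (auto simp: mod_if split: if_splits)
    define vs where "vs = w # map (\<lambda>i. q ! ((s + i) mod l)) [0..<k]"
    define es where "es = e # map (\<lambda>i. c ((s + i) mod l)) [0..<k - 1]"
    have "berge_path V H k vs es"
      unfolding berge_path_def
    proof (intro conjI allI impI)
      show "length vs = k + 1" by (simp add: vs_def)
      show "length es = k" using q(2) l by (simp add: es_def)
      have "inj_on (\<lambda>i. q ! ((s + i) mod l)) {0..<k}"
      proof (rule inj_onI)
        fix i j assume ij: "i \<in> {0..<k}" "j \<in> {0..<k}" "q ! ((s + i) mod l) = q ! ((s + j) mod l)"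
        have "(s + i) mod l = (s + j) mod l"
          using nth_eq_iff_index_eq[OF q(1), folded l_def, OF idx idx] ij(3) by blast
        then show "i = j" by (rule idx_inj) (use ij(1,2) l in auto)
      qed
      then show "distinct vs" using e(5) nth_mem[OF idx[unfolded l_def]]
        by (auto simp: vs_def distinct_map l_def)
      show "set vs \<subseteq> V" using e(1,3) HV qV nth_mem[OF idx[unfolded l_def]]
        by (auto simp: vs_def l_def)
      have "inj_on (\<lambda>i. c ((s + i) mod l)) {0..<k - 1}"
      proof (rule inj_onI)
        fix i j assume ij: "i \<in> {0..<k - 1}" "j \<in> {0..<k - 1}" "c ((s + i) mod l) = c ((s + j) mod l)"
        have "(s + i) mod l = (s + j) mod l" using ij(3) by (rule c_inj[OF idx idx])
        then show "i = j" by (rule idx_inj) (use ij(1,2) l in auto)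
      qed
      moreover have "e \<notin> set (map (\<lambda>i. c ((s + i) mod l)) [0..<k - 1])" using s(3) by auto blast
      ultimately show "distinct es" by (simp add: es_def distinct_map)
      show "set es \<subseteq> H" using e(1) c(1) idx by (auto simp: es_def)
      fix i assume i: "i < k"
      show "{vs ! i, vs ! (i + 1)} \<subseteq> es ! i"
      proof (cases i)
        case 0
        then show ?thesis using i e(3) s(1,2) by (simp add: vs_def es_def)
      next
        case (Suc j)
        then have "[0..<k - 1] ! j = j" using i by simp
        then show ?thesis using Suc i c(2,3)[OF idx[of j]] by (simp add: vs_def es_def mod_Suc_eq)
      qed
    qed
    then show ?thesis by blast
  qed
qed

section \<open>The edge bound\<close>

theorem corollary3p3:
  fixes r n k :: nat and V :: "'a set" and H :: "'a set set"
  assumes "r \<ge> 3" and "n \<ge> k + 1" and "k + 1 \<ge> r + 4"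
    and "uniform_hypergraph r V H" and "card V = n"
    and "connected_hypergraph V H"
    and "\<not> (\<exists>vs es. berge_path V H k vs es)"
  shows "real (card H) \<le> (real n - 1) / (real k - 2) * real ((k - 1) choose r)"
proof -
  obtain R B f where rep: "R \<inter> B = {} \<and> inj_on f (R \<union> B) \<and> (\<forall>p\<in>R \<union> B. p \<subseteq> f p \<and> f p \<in> H)
    \<and> card H \<le> card (cliques R V 2) + card (cliques B V r)"
    using red_blue_representation[OF assms(4)] by (elim exE)
  have "finite V" using assms(4) by (simp add: uniform_hypergraph_def)
  have short: "length q \<le> k - 1" if "cycle (R \<union> B) q" for q
  proof (rule ccontr)
    assume "\<not> length q \<le> k - 1"
    then have "\<exists>vs es. berge_path V H k vs es"
      using rep assms(2,5) that
      by (intro berge_path_of_long_cycle[OF assms(4,6), where f = f and E = "R \<union> B" and q = q]) auto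
    then show False using assms(7) by contradiction
  qed
  have "V \<noteq> {}" using assms(2,5) by auto
  have "real (card H) \<le> real (card (cliques R V 2)) + real (card (cliques B V r))"
    using rep by linarith
  also have "\<dots> \<le> real (k - 1 choose r) / (real (k - 1) - 1) * (real (card V) - 1)"
    using assms(1,3) rep
    by (intro coloured_clique_bound[OF _ _ _ short \<open>finite V\<close> \<open>V \<noteq> {}\<close>]) auto
  also have "real (k - 1) - 1 = real k - 2" using assms(1,3) by simp
  finally show ?thesis using assms(5) by (simp add: mult.commute)
qed

end
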